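(* Let $k\ge 3$ be odd. Consider the spectral sequence which converges to $\pi_\ast(Emb(I,\mathbb{R}^k\times I))$ and whose $E^1$ term is given by $E^1_{-n,\,d(k-1)+1}=M_{d,n}$ for $n\ge 0$, $d\ge 1$, with all other entries zero. In this spectral sequence, $E^1_{-p,q}=0$ if $q<p(k-1)+2-k$.
   Context: $I=[0,1]$, and $Emb(I,\mathbb{R}^k\times I)$ is the space of smooth embeddings of the interval $I$ in $\mathbb{R}^k\times I$ with fixed endpoints and fixed tangent vectors at those endpoints; $\pi_\ast(X)$ denotes the homotopy groups of $X$ tensored with $\mathbb{Q}$. $\mathcal{B}^o_n$ is the Lie algebra over $\mathbb{Q}$ generated by classes $x_{ij}$, $1\le i,j\le n$, with relations (1) $x_{ij}=x_{ji}$; (2) $x_{ii}=0$; (3) $[x_{ij},x_{\ell m}]=0$ if $\{i,j\}\cap\{\ell,m\}=\emptyset$; (4) $[x_{ij},x_{j\ell}]=[x_{j\ell},x_{\ell i}]=[x_{\ell i},x_{ij}]$. Let $\Lambda^o$ be the free Lie algebra over $\mathbb{Q}$ on one generator, and let $\mathcal{BT}^o_n=\mathcal{B}^o_n\oplus n\Lambda^o$ (direct sum of Lie algebras), where $n\Lambda^o$ is the direct sum of $n$ copies of $\Lambda^o$ with generators $y_1,\dots,y_n$. It is graded by the number of generators appearing in a bracket (each $x_{ij}$ and $y_i$ has degree 1). For $n>1$ and $d\ge 1$, $M_{d,n}$ is the submodule of the degree $d$ summand of $\mathcal{BT}^o_n$ spanned by (iterated, degree $d$) brackets of the classes $x_{in}$,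 $1\le i\le n-1$, such that each $i$ from $1$ to $n-1$ appears as an index. Also $M_{1,1}=\mathcal{BT}^o_1$, and $M_{d,1}=0$ for $d>1$, $M_{d,0}=0$. The differential of this spectral sequence is $d^1=\sum_{i=0}^{n+1}(-1)^i\partial^i$ restricted to $M_{d,n}$, where $\partial^\ell:\mathcal{BT}^o_n\to\mathcal{BT}^o_{n+1}$ is the Lie algebra homomorphism with (for $\sigma^\ell(i)=i$ if $i<\ell$, $\sigma^\ell(i)=i+1$ if $i>\ell$) $\partial^\ell(x_{ij})=x_{\sigma^\ell(i)\sigma^\ell(j)}$ if $i,j\ne\ell$, $\partial^\ell(x_{ij})=x_{i,\sigma^\ell(j)}+x_{i+1,\sigma^\ell(j)}$ if $i=\ell\ne j$ (the case $j=\ell\ne i$ is determined by $x_{ij}=x_{ji}$), $\partial^\ell(y_i)=y_{\sigma^\ell(i)}$ if $i\neq\ell$, and $\partial^\ell(y_\ell)=x_{\ell,\ell+1}+y_\ell+y_{\ell+1}$. *)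

theory Defs
  imports "HOL-Analysis.Analysis" "HOL-Library.Poly_Mapping" "HOL-Algebra.Algebra"
begin

section \<open>Modules over the rationals\<close>

definition rat_ring :: "rat ring" where
  "rat_ring = \<lparr>carrier = UNIV, mult = (*), one = 1, ring.zero = 0, add = (+)\<rparr>"

type_synonym 'a rmod = "(rat, 'a) module"

definition mod_hom :: "'a rmod \<Rightarrow> 'b rmod \<Rightarrow> ('a \<Rightarrow> 'b) set" where
  "mod_hom M N = {f \<in> carrier M \<rightarrow> carrier N.
     (\<forall>x\<in>carrier M. \<forall>y\<in>carrier M. f (x \<oplus>\<^bsub>M\<^esub> y) = f x \<oplus>\<^bsub>N\<^esub> f y) \<and>
     (\<forall>r. \<forall>x\<in>carrier M. f (r \<odot>\<^bsub>M\<^esub> x) = r \<odot>\<^bsub>N\<^esub> f x)}"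

definition mod_iso :: "'a rmod \<Rightarrow> 'b rmod \<Rightarrow> ('a \<Rightarrow> 'b) set" where
  "mod_iso M N = {f \<in> mod_hom M N. bij_betw f (carrier M) (carrier N)}"

definition restrict_mod :: "'a rmod \<Rightarrow> 'a set \<Rightarrow> 'a rmod" where
  "restrict_mod M H = M\<lparr>carrier := H\<rparr>"

definition mod_span :: "'a rmod \<Rightarrow> 'a set \<Rightarrow> 'a set" where
  "mod_span M S = (\<lambda>H. submodule H rat_ring M) hull S"

text \<open>The multiplication on cosets is only meaningful if \<open>N\<close> is an ideal for the
  multiplication of \<open>M\<close>; for plain modules it plays no role.\<close>

definition quot_mod :: "'a rmod \<Rightarrow> 'a set \<Rightarrow> 'a set rmod" where
  "quot_mod M N = \<lparr>carrier = a_rcosets\<^bsub>M\<^esub> N, mult = rcoset_mult M N, one = N +>\<^bsub>M\<^esub> \<one>\<^bsub>M\<^esub>,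
     ring.zero = N, add = set_add M, smult = (\<lambda>r A. \<Union>a\<in>A. N +>\<^bsub>M\<^esub> (r \<odot>\<^bsub>M\<^esub> a))\<rparr>"

definition zero_mod :: "'a rmod \<Rightarrow> bool" where
  "zero_mod M \<longleftrightarrow> carrier M = {\<zero>\<^bsub>M\<^esub>}"

definition free_mod :: "'a set \<Rightarrow> ('a \<Rightarrow>\<^sub>0 rat) rmod" where
  "free_mod S = \<lparr>carrier = {f. Poly_Mapping.keys f \<subseteq> S}, mult = (\<lambda>_ _. 0), one = 0,
     ring.zero = 0, add = (+), smult = (\<lambda>r. Poly_Mapping.map ((*) r))\<rparr>"


section \<open>Lie algebras over the rationals\<close>

text \<open>A Lie algebra is a module record whose (otherwise unused) field \<open>mult\<close> holds the
  bracket; the field \<open>one\<close> carries no meaning.\<close>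

definition lie_algebra :: "'a rmod \<Rightarrow> bool" where
  "lie_algebra L \<longleftrightarrow> Module.module rat_ring L \<and>
     (\<forall>x\<in>carrier L. \<forall>y\<in>carrier L. x \<otimes>\<^bsub>L\<^esub> y \<in> carrier L) \<and>
     (\<forall>x\<in>carrier L. \<forall>y\<in>carrier L. \<forall>z\<in>carrier L.
        (x \<oplus>\<^bsub>L\<^esub> y) \<otimes>\<^bsub>L\<^esub> z = (x \<otimes>\<^bsub>L\<^esub> z) \<oplus>\<^bsub>L\<^esub> (y \<otimes>\<^bsub>L\<^esub> z) \<and>
        z \<otimes>\<^bsub>L\<^esub> (x \<oplus>\<^bsub>L\<^esub> y) = (z \<otimes>\<^bsub>L\<^esub> x) \<oplus>\<^bsub>L\<^esub> (z \<otimes>\<^bsub>L\<^esub> y)) \<and>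
     (\<forall>r. \<forall>x\<in>carrier L. \<forall>y\<in>carrier L.
        (r \<odot>\<^bsub>L\<^esub> x) \<otimes>\<^bsub>L\<^esub> y = r \<odot>\<^bsub>L\<^esub> (x \<otimes>\<^bsub>L\<^esub> y) \<and> x \<otimes>\<^bsub>L\<^esub> (r \<odot>\<^bsub>L\<^esub> y) = r \<odot>\<^bsub>L\<^esub> (x \<otimes>\<^bsub>L\<^esub> y)) \<and>
     (\<forall>x\<in>carrier L. x \<otimes>\<^bsub>L\<^esub> x = \<zero>\<^bsub>L\<^esub>) \<and>
     (\<forall>x\<in>carrier L. \<forall>y\<in>carrier L. \<forall>z\<in>carrier L.
        x \<otimes>\<^bsub>L\<^esub> (y \<otimes>\<^bsub>L\<^esub> z) \<oplus>\<^bsub>L\<^esub> (y \<otimes>\<^bsub>L\<^esub> (z \<otimes>\<^bsub>L\<^esub> x) \<oplus>\<^bsub>L\<^esub> z \<otimes>\<^bsub>L\<^esub> (x \<otimes>\<^bsub>L\<^esub> y)) = \<zero>\<^bsub>L\<^esub>)"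

definition lie_hom :: "'a rmod \<Rightarrow> 'b rmod \<Rightarrow> ('a \<Rightarrow> 'b) set" where
  "lie_hom L K = {f \<in> mod_hom L K. \<forall>x\<in>carrier L. \<forall>y\<in>carrier L. f (x \<otimes>\<^bsub>L\<^esub> y) = f x \<otimes>\<^bsub>K\<^esub> f y}"

definition lie_ideal :: "'a rmod \<Rightarrow> 'a set \<Rightarrow> bool" where
  "lie_ideal L I \<longleftrightarrow> submodule I rat_ring L \<and>
     (\<forall>a\<in>carrier L. \<forall>x\<in>I. a \<otimes>\<^bsub>L\<^esub> x \<in> I \<and> x \<otimes>\<^bsub>L\<^esub> a \<in> I)"

definition lie_sum :: "'a rmod \<Rightarrow> 'b rmod \<Rightarrow> ('a \<times> 'b) rmod" where
  "lie_sum L K = \<lparr>carrier = carrier L \<times> carrier K,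
     mult = (\<lambda>(a, b) (a', b'). (a \<otimes>\<^bsub>L\<^esub> a', b \<otimes>\<^bsub>K\<^esub> b')), one = (\<one>\<^bsub>L\<^esub>, \<one>\<^bsub>K\<^esub>),
     ring.zero = (\<zero>\<^bsub>L\<^esub>, \<zero>\<^bsub>K\<^esub>),
     add = (\<lambda>(a, b) (a', b'). (a \<oplus>\<^bsub>L\<^esub> a', b \<oplus>\<^bsub>K\<^esub> b')),
     smult = (\<lambda>r (a, b). (r \<odot>\<^bsub>L\<^esub> a, r \<odot>\<^bsub>K\<^esub> b))\<rparr>"

definition lie_copies :: "nat \<Rightarrow> 'a rmod \<Rightarrow> (nat \<Rightarrow> 'a) rmod" where
  "lie_copies n L = \<lparr>carrier = (\<Pi>\<^sub>E i\<in>{1..n}. carrier L),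
     mult = (\<lambda>f g. \<lambda>i\<in>{1..n}. f i \<otimes>\<^bsub>L\<^esub> g i), one = (\<lambda>i\<in>{1..n}. \<one>\<^bsub>L\<^esub>),
     ring.zero = (\<lambda>i\<in>{1..n}. \<zero>\<^bsub>L\<^esub>),
     add = (\<lambda>f g. \<lambda>i\<in>{1..n}. f i \<oplus>\<^bsub>L\<^esub> g i),
     smult = (\<lambda>r f. \<lambda>i\<in>{1..n}. r \<odot>\<^bsub>L\<^esub> f i)\<rparr>"

datatype (gens: 'g) bracket = Gen 'g | Br "'g bracket" "'g bracket"

primrec weight :: "'g bracket \<Rightarrow> nat" where
  "weight (Gen g) = 1"
| "weight (Br s t) = weight s + weight t"

primrec eval_bracket :: "'a rmod \<Rightarrow> ('g \<Rightarrow> 'a) \<Rightarrow> 'g bracket \<Rightarrow> 'a" where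
  "eval_bracket L \<phi> (Gen g) = \<phi> g"
| "eval_bracket L \<phi> (Br s t) = eval_bracket L \<phi> s \<otimes>\<^bsub>L\<^esub> eval_bracket L \<phi> t"

text \<open>The free nonassociative algebra on \<open>S\<close> has the formal brackets in \<open>S\<close> as basis.\<close>

definition formal_mult :: "('g bracket \<Rightarrow>\<^sub>0 rat) \<Rightarrow> ('g bracket \<Rightarrow>\<^sub>0 rat) \<Rightarrow> ('g bracket \<Rightarrow>\<^sub>0 rat)" where
  "formal_mult f g = (\<Sum>s\<in>Poly_Mapping.keys f. \<Sum>t\<in>Poly_Mapping.keys g.
     Poly_Mapping.single (Br s t) (Poly_Mapping.lookup f s * Poly_Mapping.lookup g t))"

definition free_nonassoc :: "'g set \<Rightarrow> ('g bracket \<Rightarrow>\<^sub>0 rat) rmod" where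
  "free_nonassoc S = (free_mod {t. gens t \<subseteq> S}) \<lparr>mult := formal_mult\<rparr>"

definition formal_gen :: "'g \<Rightarrow> ('g bracket \<Rightarrow>\<^sub>0 rat)" where
  "formal_gen g = Poly_Mapping.single (Gen g) 1"

definition lie_axiom_rels :: "'g set \<Rightarrow> ('g bracket \<Rightarrow>\<^sub>0 rat) set" where
  "lie_axiom_rels S =
     {formal_mult a a | a. a \<in> carrier (free_nonassoc S)} \<union>
     {formal_mult a (formal_mult b c) + formal_mult b (formal_mult c a)
        + formal_mult c (formal_mult a b) | a b c.
        a \<in> carrier (free_nonassoc S) \<and> b \<in> carrier (free_nonassoc S) \<and> c \<in> carrier (free_nonassoc S)}"

definition relation_ideal :: "'g set \<Rightarrow> ('g bracket \<Rightarrow>\<^sub>0 rat) set \<Rightarrow> ('g bracket \<Rightarrow>\<^sub>0 rat) set" where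
  "relation_ideal S R = lie_ideal (free_nonassoc S) hull (lie_axiom_rels S \<union> R)"

text \<open>The Lie algebra over the rationals with generators \<open>S\<close> and relations \<open>r = 0\<close> for \<open>r \<in> R\<close>.\<close>

definition presented_lie :: "'g set \<Rightarrow> ('g bracket \<Rightarrow>\<^sub>0 rat) set \<Rightarrow> ('g bracket \<Rightarrow>\<^sub>0 rat) set rmod" where
  "presented_lie S R = quot_mod (free_nonassoc S) (relation_ideal S R)"

definition presented_gen ::
  "'g set \<Rightarrow> ('g bracket \<Rightarrow>\<^sub>0 rat) set \<Rightarrow> 'g \<Rightarrow> ('g bracket \<Rightarrow>\<^sub>0 rat) set" where
  "presented_gen S R g = relation_ideal S R +>\<^bsub>free_nonassoc S\<^esub> formal_gen g"


section \<open>The Lie algebras \<open>\<B>\<T>\<^sup>o\<^sub>n\<close> and the modules \<open>M\<^sub>d\<^sub>,\<^sub>n\<close>\<close>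

definition Bo_gens :: "nat \<Rightarrow> (nat \<times> nat) set" where
  "Bo_gens n = {1..n} \<times> {1..n}"

abbreviation formal_x :: "nat \<Rightarrow> nat \<Rightarrow> ((nat \<times> nat) bracket \<Rightarrow>\<^sub>0 rat)" where
  "formal_x i j \<equiv> formal_gen (i, j)"

definition Bo_rels :: "nat \<Rightarrow> ((nat \<times> nat) bracket \<Rightarrow>\<^sub>0 rat) set" where
  "Bo_rels n =
     {formal_x i j - formal_x j i | i j. i \<in> {1..n} \<and> j \<in> {1..n}} \<union>
     {formal_x i i | i. i \<in> {1..n}} \<union>
     {formal_mult (formal_x i j) (formal_x l m) | i j l m.
        i \<in> {1..n} \<and> j \<in> {1..n} \<and> l \<in> {1..n} \<and> m \<in> {1..n} \<and> {i, j} \<inter> {l, m} = {}} \<union>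
     {formal_mult (formal_x i j) (formal_x j l) - formal_mult (formal_x j l) (formal_x l i) | i j l.
        i \<in> {1..n} \<and> j \<in> {1..n} \<and> l \<in> {1..n}} \<union>
     {formal_mult (formal_x j l) (formal_x l i) - formal_mult (formal_x l i) (formal_x i j) | i j l.
        i \<in> {1..n} \<and> j \<in> {1..n} \<and> l \<in> {1..n}}"

definition Bo :: "nat \<Rightarrow> ((nat \<times> nat) bracket \<Rightarrow>\<^sub>0 rat) set rmod" where
  "Bo n = presented_lie (Bo_gens n) (Bo_rels n)"

definition Lambda_o :: "(unit bracket \<Rightarrow>\<^sub>0 rat) set rmod" where
  "Lambda_o = presented_lie UNIV {}"

type_synonym bto =
  "((nat \<times> nat) bracket \<Rightarrow>\<^sub>0 rat) set \<times> (nat \<Rightarrow> (unit bracket \<Rightarrow>\<^sub>0 rat) set)"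

definition BTo :: "nat \<Rightarrow> bto rmod" where
  "BTo n = lie_sum (Bo n) (lie_copies n Lambda_o)"

definition x_gen :: "nat \<Rightarrow> nat \<Rightarrow> nat \<Rightarrow> bto" where
  "x_gen n i j = (presented_gen (Bo_gens n) (Bo_rels n) (i, j), \<zero>\<^bsub>lie_copies n Lambda_o\<^esub>)"

definition y_gen :: "nat \<Rightarrow> nat \<Rightarrow> bto" where
  "y_gen n i =
     (\<zero>\<^bsub>Bo n\<^esub>, \<lambda>j\<in>{1..n}. if j = i then presented_gen UNIV {} () else \<zero>\<^bsub>Lambda_o\<^esub>)"

definition M_mod :: "nat \<Rightarrow> nat \<Rightarrow> bto rmod" where
  "M_mod d n = restrict_mod (BTo n)
     (if n > 1 then
        mod_span (BTo n) {eval_bracket (BTo n) (\<lambda>i. x_gen n i n) t | t. weight t = d \<and> gens t = {1..n-1}}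
      else if n = 1 \<and> d = 1 then carrier (BTo 1)
      else {\<zero>\<^bsub>BTo n\<^esub>})"

text \<open>The index map \<open>\<sigma>\<^sup>l\<close> is only ever applied to \<open>i \<noteq> l\<close>.\<close>

definition skip :: "nat \<Rightarrow> nat \<Rightarrow> nat" where
  "skip l i = (if i < l then i else i + 1)"

definition is_coface :: "nat \<Rightarrow> nat \<Rightarrow> (bto \<Rightarrow> bto) \<Rightarrow> bool" where
  "is_coface n l f \<longleftrightarrow> f \<in> lie_hom (BTo n) (BTo (n + 1)) \<and>
     (\<forall>i\<in>{1..n}. \<forall>j\<in>{1..n}.
        (i \<noteq> l \<and> j \<noteq> l \<longrightarrow> f (x_gen n i j) = x_gen (n + 1) (skip l i) (skip l j)) \<and>
        (i = l \<and> j \<noteq> l \<longrightarrow>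
           f (x_gen n i j) = x_gen (n + 1) i (skip l j) \<oplus>\<^bsub>BTo (n + 1)\<^esub> x_gen (n + 1) (i + 1) (skip l j))) \<and>
     (\<forall>i\<in>{1..n}.
        (i \<noteq> l \<longrightarrow> f (y_gen n i) = y_gen (n + 1) (skip l i)) \<and>
        (i = l \<longrightarrow> f (y_gen n i) =
           x_gen (n + 1) l (l + 1) \<oplus>\<^bsub>BTo (n + 1)\<^esub> (y_gen (n + 1) l \<oplus>\<^bsub>BTo (n + 1)\<^esub> y_gen (n + 1) (l + 1))))"

definition coface_sum :: "(nat \<Rightarrow> nat \<Rightarrow> bto \<Rightarrow> bto) \<Rightarrow> nat \<Rightarrow> bto \<Rightarrow> bto" where
  "coface_sum \<delta> n x = (\<Oplus>\<^bsub>BTo (n + 1)\<^esub>i\<in>{0..n + 1}. ((-1) ^ i) \<odot>\<^bsub>BTo (n + 1)\<^esub> \<delta> n i x)"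


section \<open>Spectral sequences\<close>

text \<open>Homological indexing: \<open>D r p q\<close> maps \<open>E r p q\<close> to \<open>E r (p - r) (q + r - 1)\<close>, with first page \<open>E 1\<close>.\<close>

definition cycles :: "(nat \<Rightarrow> int \<Rightarrow> int \<Rightarrow> 'v rmod) \<Rightarrow> (nat \<Rightarrow> int \<Rightarrow> int \<Rightarrow> 'v \<Rightarrow> 'v) \<Rightarrow>
    nat \<Rightarrow> int \<Rightarrow> int \<Rightarrow> 'v set" where
  "cycles E D r p q =
     {x \<in> carrier (E r p q). D r p q x = \<zero>\<^bsub>E r (p - int r) (q + int r - 1)\<^esub>}"

definition boundaries :: "(nat \<Rightarrow> int \<Rightarrow> int \<Rightarrow> 'v rmod) \<Rightarrow> (nat \<Rightarrow> int \<Rightarrow> int \<Rightarrow> 'v \<Rightarrow> 'v) \<Rightarrow>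
    nat \<Rightarrow> int \<Rightarrow> int \<Rightarrow> 'v set" where
  "boundaries E D r p q =
     D r (p + int r) (q - int r + 1) ` carrier (E r (p + int r) (q - int r + 1))"

definition spectral_sequence ::
    "(nat \<Rightarrow> int \<Rightarrow> int \<Rightarrow> 'v rmod) \<Rightarrow> (nat \<Rightarrow> int \<Rightarrow> int \<Rightarrow> 'v \<Rightarrow> 'v) \<Rightarrow> bool" where
  "spectral_sequence E D \<longleftrightarrow> (\<forall>r\<ge>1. \<forall>p q.
     Module.module rat_ring (E r p q) \<and>
     D r p q \<in> mod_hom (E r p q) (E r (p - int r) (q + int r - 1)) \<and>
     boundaries E D r p q \<subseteq> cycles E D r p q \<and>
     mod_iso (quot_mod (restrict_mod (E r p q) (cycles E D r p q)) (boundaries E D r p q))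
       (E (r + 1) p q) \<noteq> {})"

text \<open>Convergence to \<open>H m\<close>, \<open>m \<ge> 1\<close>: a finite filtration of each \<open>H m\<close> by submodules whose
  quotients are the stable values \<open>E\<^sup>\<infinity>\<^sub>p\<^sub>,\<^sub>q\<close> with \<open>p + q = m\<close>.  The degree \<open>m = 0\<close> is left out,
  as the set of path components is not a group.\<close>

definition converges_to ::
    "(nat \<Rightarrow> int \<Rightarrow> int \<Rightarrow> 'v rmod) \<Rightarrow> (nat \<Rightarrow> int \<Rightarrow> int \<Rightarrow> 'v \<Rightarrow> 'v) \<Rightarrow> (nat \<Rightarrow> 'h rmod) \<Rightarrow> bool" where
  "converges_to E D H \<longleftrightarrow> (\<forall>m\<ge>1. \<exists>F :: int \<Rightarrow> 'h set.
     (\<forall>p. submodule (F p) rat_ring (H m)) \<and> mono F \<and>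
     (\<exists>p. F p = {\<zero>\<^bsub>H m\<^esub>}) \<and> (\<exists>p. F p = carrier (H m)) \<and>
     (\<forall>p q. p + q = int m \<longrightarrow> (\<exists>r0\<ge>1. \<forall>r\<ge>r0.
        cycles E D r p q = carrier (E r p q) \<and> boundaries E D r p q = {\<zero>\<^bsub>E r p q\<^esub>} \<and>
        mod_iso (E r p q) (quot_mod (restrict_mod (H m) (F p)) (F (p - 1))) \<noteq> {})))"


section \<open>Rational homotopy groups\<close>

definition cube :: "nat \<Rightarrow> (nat \<Rightarrow> real) topology" where
  "cube j = product_topology (\<lambda>_. top_of_set {0..1}) {..<j}"

definition cube_boundary :: "nat \<Rightarrow> (nat \<Rightarrow> real) set" where
  "cube_boundary j = {s \<in> topspace (cube j). \<exists>i<j. s i = 0 \<or> s i = 1}"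

definition spheroids :: "nat \<Rightarrow> 'x topology \<Rightarrow> 'x \<Rightarrow> ((nat \<Rightarrow> real) \<Rightarrow> 'x) set" where
  "spheroids j T x0 = {f. continuous_map (cube j) T f \<and> f ` cube_boundary j \<subseteq> {x0}}"

definition spheroid_class ::
    "nat \<Rightarrow> 'x topology \<Rightarrow> 'x \<Rightarrow> ((nat \<Rightarrow> real) \<Rightarrow> 'x) \<Rightarrow> ((nat \<Rightarrow> real) \<Rightarrow> 'x) set" where
  "spheroid_class j T x0 f = {g \<in> spheroids j T x0.
     homotopic_with (\<lambda>h. h ` cube_boundary j \<subseteq> {x0}) (cube j) T f g}"

definition spheroid_mult ::
    "((nat \<Rightarrow> real) \<Rightarrow> 'x) \<Rightarrow> ((nat \<Rightarrow> real) \<Rightarrow> 'x) \<Rightarrow> ((nat \<Rightarrow> real) \<Rightarrow> 'x)" where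
  "spheroid_mult f g = (\<lambda>s. if s 0 \<le> 1/2 then f (s(0 := 2 * s 0)) else g (s(0 := 2 * s 0 - 1)))"

definition homotopy_group ::
    "nat \<Rightarrow> 'x topology \<Rightarrow> 'x \<Rightarrow> ((nat \<Rightarrow> real) \<Rightarrow> 'x) set monoid" where
  "homotopy_group j T x0 = \<lparr>carrier = spheroid_class j T x0 ` spheroids j T x0,
     mult = (\<lambda>A B. \<Union>f\<in>A. \<Union>g\<in>B. spheroid_class j T x0 (spheroid_mult f g)),
     one = spheroid_class j T x0 (\<lambda>_. x0)\<rparr>"

text \<open>The tensor product of the abelian group \<open>G\<close> with the rationals: the rational vector space
  on the symbols \<open>[a]\<close>, \<open>a \<in> G\<close>, modulo \<open>[a b] = [a] + [b]\<close>.\<close>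

definition tensor_rat :: "'a monoid \<Rightarrow> ('a \<Rightarrow>\<^sub>0 rat) set rmod" where
  "tensor_rat G = (let F = free_mod (carrier G) in quot_mod F (mod_span F
     {Poly_Mapping.single (a \<otimes>\<^bsub>G\<^esub> b) 1 - Poly_Mapping.single a 1 - Poly_Mapping.single b 1 | a b.
        a \<in> carrier G \<and> b \<in> carrier G}))"

definition rational_homotopy ::
    "'x topology \<Rightarrow> 'x \<Rightarrow> nat \<Rightarrow> (((nat \<Rightarrow> real) \<Rightarrow> 'x) set \<Rightarrow>\<^sub>0 rat) set rmod" where
  "rational_homotopy T x0 j = tensor_rat (homotopy_group j T x0)"


section \<open>The space of embeddings of the interval\<close>

definition nth_deriv :: "nat \<Rightarrow> (real \<Rightarrow> 'a::real_normed_vector) \<Rightarrow> real \<Rightarrow> 'a" where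
  "nth_deriv m f = ((\<lambda>g t. vector_derivative g (at t within {0..1})) ^^ m) f"

definition smooth_on_I :: "(real \<Rightarrow> 'a::real_normed_vector) \<Rightarrow> bool" where
  "smooth_on_I f \<longleftrightarrow> (\<forall>m. \<forall>t\<in>{0..1}. nth_deriv m f differentiable (at t within {0..1}))"

text \<open>Since the interval is compact, the embeddings are the injective immersions.
  The endpoints are \<open>(a, 0)\<close> and \<open>(b, 1)\<close>, with tangent vectors \<open>u\<close> and \<open>v\<close>.\<close>

definition emb_space :: "'w::real_normed_vector \<Rightarrow> 'w \<Rightarrow> 'w \<times> real \<Rightarrow> 'w \<times> real \<Rightarrow>
    (real \<Rightarrow> 'w \<times> real) set" where
  "emb_space a b u v = {f \<in> {0..1} \<rightarrow>\<^sub>E UNIV \<times> {0..1}.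
     smooth_on_I f \<and> inj_on f {0..1} \<and> (\<forall>t\<in>{0..1}. nth_deriv 1 f t \<noteq> 0) \<and>
     f 0 = (a, 0) \<and> f 1 = (b, 1) \<and> nth_deriv 1 f 0 = u \<and> nth_deriv 1 f 1 = v}"

text \<open>The topology of uniform convergence of all derivatives.\<close>

definition emb_topology :: "'w::real_normed_vector \<Rightarrow> 'w \<Rightarrow> 'w \<times> real \<Rightarrow> 'w \<times> real \<Rightarrow>
    (real \<Rightarrow> 'w \<times> real) topology" where
  "emb_topology a b u v = topology_generated_by
     {{g \<in> emb_space a b u v. \<forall>t\<in>{0..1}. dist (nth_deriv m g t) (nth_deriv m f t) < e} | f m e.
        f \<in> emb_space a b u v \<and> e > 0}"


section \<open>The constructions yield Lie algebras\<close>

lemma rat_ring_sel [simp]: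
  "carrier rat_ring = UNIV" "mult rat_ring = (*)" "one rat_ring = 1"
  "ring.zero rat_ring = 0" "add rat_ring = (+)"
  by (simp_all add: rat_ring_def)

lemma field_rat_ring: "field rat_ring"
  apply (rule cring.cring_fieldI2)
  subgoal
    apply (rule cringI)
    subgoal
      apply (rule abelian_groupI)
           apply (auto simp: algebra_simps)
      by (metis add.right_inverse)
    subgoal by (rule comm_monoidI) (auto simp: algebra_simps)
    by (auto simp: algebra_simps)
  apply simp
  apply simp
  by (metis UNIV_I dvdE dvd_field_iff mult.commute rat_ring_sel)

lemma module_quot_mod:
  assumes M: "Module.module rat_ring M" and N: "submodule N rat_ring M"
  shows "Module.module rat_ring (quot_mod M N)"
proof -
  interpret M: Module.module rat_ring M by fact
  interpret N: submodule N rat_ring M by fact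
  have ag: "abelian_group M" by (rule M.abelian_group_axioms)
  interpret S: abelian_subgroup N M
    by (rule abelian_subgroupI3) (simp_all add: additive_subgroup_def N.subgroup_axioms ag)
  have cg: "comm_group (M A_Mod N)" by (rule S.a_factorgroup_is_comm_group)
  have sm: "(\<Union>a\<in>N +>\<^bsub>M\<^esub> x. N +>\<^bsub>M\<^esub> (r \<odot>\<^bsub>M\<^esub> a)) = N +>\<^bsub>M\<^esub> (r \<odot>\<^bsub>M\<^esub> x)"
    if x: "x \<in> carrier M" for r x
  proof -
    have "N +>\<^bsub>M\<^esub> (r \<odot>\<^bsub>M\<^esub> a) = N +>\<^bsub>M\<^esub> (r \<odot>\<^bsub>M\<^esub> x)" if a: "a \<in> N +>\<^bsub>M\<^esub> x" for a
    proof -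
      obtain h where h: "h \<in> N" "a = h \<oplus>\<^bsub>M\<^esub> x" using a by (auto simp: a_r_coset_def')
      have hc: "h \<in> carrier M" using h S.a_Hcarr by blast
      have "r \<odot>\<^bsub>M\<^esub> a = (r \<odot>\<^bsub>M\<^esub> h) \<oplus>\<^bsub>M\<^esub> (r \<odot>\<^bsub>M\<^esub> x)"
        using h x hc M.smult_r_distr[of r h x] by simp
      moreover have "r \<odot>\<^bsub>M\<^esub> h \<in> N" using N.smult_closed h by simp
      ultimately have "r \<odot>\<^bsub>M\<^esub> a \<in> N +>\<^bsub>M\<^esub> (r \<odot>\<^bsub>M\<^esub> x)" by (auto simp: a_r_coset_def')
      then show ?thesis using S.a_repr_independence' M.smult_closed[of r x] x by simp
    qed
    moreover have "x \<in> N +>\<^bsub>M\<^esub> x" using x S.a_rcos_self by blast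
    ultimately show ?thesis by blast
  qed
  have ad: "(N +>\<^bsub>M\<^esub> x) <+>\<^bsub>M\<^esub> (N +>\<^bsub>M\<^esub> y) = N +>\<^bsub>M\<^esub> (x \<oplus>\<^bsub>M\<^esub> y)"
    if "x \<in> carrier M" "y \<in> carrier M" for x y using S.a_rcos_sum that by blast
  have rep: "\<exists>x\<in>carrier M. A = N +>\<^bsub>M\<^esub> x" if "A \<in> a_rcosets\<^bsub>M\<^esub> N" for A
    using that by (auto simp: A_RCOSETS_def')
  have repc: "x \<in> carrier M \<Longrightarrow> N +>\<^bsub>M\<^esub> x \<in> a_rcosets\<^bsub>M\<^esub> N" for x
    by (auto simp: A_RCOSETS_def')
  have c: "carrier (quot_mod M N) = a_rcosets\<^bsub>M\<^esub> N" by (simp add: quot_mod_def)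
  have a: "x \<in> carrier M \<Longrightarrow> y \<in> carrier M \<Longrightarrow> (N +>\<^bsub>M\<^esub> x) \<oplus>\<^bsub>quot_mod M N\<^esub> (N +>\<^bsub>M\<^esub> y) = N +>\<^bsub>M\<^esub> (x \<oplus>\<^bsub>M\<^esub> y)" for x y
    using ad by (simp add: quot_mod_def)
  have z: "\<zero>\<^bsub>quot_mod M N\<^esub> = N +>\<^bsub>M\<^esub> \<zero>\<^bsub>M\<^esub>"
    using S.a_rcos_const[of "\<zero>\<^bsub>M\<^esub>"] S.zero_closed by (simp add: quot_mod_def)
  have rep': "A \<in> carrier (quot_mod M N) \<Longrightarrow> \<exists>x\<in>carrier M. A = N +>\<^bsub>M\<^esub> x" for A using rep c by auto
  have abg: "abelian_group (quot_mod M N)"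
  proof (rule abelian_groupI)
    fix A B assume AB: "A \<in> carrier (quot_mod M N)" "B \<in> carrier (quot_mod M N)"
    then obtain x y where xy: "x \<in> carrier M" "A = N +>\<^bsub>M\<^esub> x" "y \<in> carrier M" "B = N +>\<^bsub>M\<^esub> y"
      using rep' by metis
    then show "A \<oplus>\<^bsub>quot_mod M N\<^esub> B \<in> carrier (quot_mod M N)"
       "A \<oplus>\<^bsub>quot_mod M N\<^esub> B = B \<oplus>\<^bsub>quot_mod M N\<^esub> A"
      by (simp_all add: a c repc M.a_comm)
    fix C assume "C \<in> carrier (quot_mod M N)"
    then obtain w where "w \<in> carrier M" "C = N +>\<^bsub>M\<^esub> w" using rep' by metis
    then show "A \<oplus>\<^bsub>quot_mod M N\<^esub> B \<oplus>\<^bsub>quot_mod M N\<^esub> C = A \<oplus>\<^bsub>quot_mod M N\<^esub> (B \<oplus>\<^bsub>quot_mod M N\<^esub> C)"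
      using xy by (simp add: a M.a_assoc)
  next
    show "\<zero>\<^bsub>quot_mod M N\<^esub> \<in> carrier (quot_mod M N)" by (simp add: z c repc)
    fix A assume "A \<in> carrier (quot_mod M N)"
    then obtain x where x: "x \<in> carrier M" "A = N +>\<^bsub>M\<^esub> x" using rep' by metis
    then show "\<zero>\<^bsub>quot_mod M N\<^esub> \<oplus>\<^bsub>quot_mod M N\<^esub> A = A" by (simp add: z a)
    have "(N +>\<^bsub>M\<^esub> \<ominus>\<^bsub>M\<^esub> x) \<oplus>\<^bsub>quot_mod M N\<^esub> A = \<zero>\<^bsub>quot_mod M N\<^esub>"
      using x by (simp add: z a M.l_neg)
    then show "\<exists>B\<in>carrier (quot_mod M N). B \<oplus>\<^bsub>quot_mod M N\<^esub> A = \<zero>\<^bsub>quot_mod M N\<^esub>"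
      using x c repc M.a_inv_closed by auto
  qed
  have s: "x \<in> carrier M \<Longrightarrow> r \<odot>\<^bsub>quot_mod M N\<^esub> (N +>\<^bsub>M\<^esub> x) = N +>\<^bsub>M\<^esub> (r \<odot>\<^bsub>M\<^esub> x)" for r x
    using sm by (simp add: quot_mod_def)
  have rsm: "r \<odot>\<^bsub>M\<^esub> x \<in> carrier M" if "x \<in> carrier M" for r x using that M.smult_closed[of r x] by simp
  show ?thesis
  proof (rule moduleI)
    show "cring rat_ring" using field_rat_ring by (simp add: field_def domain_def)
    show "abelian_group (quot_mod M N)" by (rule abg)
  next
    fix r A assume "A \<in> carrier (quot_mod M N)"
    then obtain x where "x \<in> carrier M" "A = N +>\<^bsub>M\<^esub> x" using rep c by auto
    then show "r \<odot>\<^bsub>quot_mod M N\<^esub> A \<in> carrier (quot_mod M N)" by (simp add: s c repc rsm)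
  next
    fix r q A assume "A \<in> carrier (quot_mod M N)"
    then obtain x where "x \<in> carrier M" "A = N +>\<^bsub>M\<^esub> x" using rep c by auto
    then show "(r \<oplus>\<^bsub>rat_ring\<^esub> q) \<odot>\<^bsub>quot_mod M N\<^esub> A = r \<odot>\<^bsub>quot_mod M N\<^esub> A \<oplus>\<^bsub>quot_mod M N\<^esub> q \<odot>\<^bsub>quot_mod M N\<^esub> A"
      using M.smult_l_distr[of r q x] by (simp add: s a rsm)
  next
    fix r A B assume "A \<in> carrier (quot_mod M N)" "B \<in> carrier (quot_mod M N)"
    then obtain x y where "x \<in> carrier M" "A = N +>\<^bsub>M\<^esub> x" "y \<in> carrier M" "B = N +>\<^bsub>M\<^esub> y"
      using rep c by metis
    then show "r \<odot>\<^bsub>quot_mod M N\<^esub> (A \<oplus>\<^bsub>quot_mod M N\<^esub> B) = r \<odot>\<^bsub>quot_mod M N\<^esub> A \<oplus>\<^bsub>quot_mod M N\<^esub> r \<odot>\<^bsub>quot_mod M N\<^esub> B"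
      using M.smult_r_distr[of r x y] by (simp add: s a rsm)
  next
    fix r q A assume "A \<in> carrier (quot_mod M N)"
    then obtain x where "x \<in> carrier M" "A = N +>\<^bsub>M\<^esub> x" using rep c by auto
    then show "(r \<otimes>\<^bsub>rat_ring\<^esub> q) \<odot>\<^bsub>quot_mod M N\<^esub> A = r \<odot>\<^bsub>quot_mod M N\<^esub> (q \<odot>\<^bsub>quot_mod M N\<^esub> A)"
      using M.smult_assoc1[of r q x] by (simp add: s a rsm)
  next
    fix A assume "A \<in> carrier (quot_mod M N)"
    then obtain x where "x \<in> carrier M" "A = N +>\<^bsub>M\<^esub> x" using rep c by auto
    then show "\<one>\<^bsub>rat_ring\<^esub> \<odot>\<^bsub>quot_mod M N\<^esub> A = A"
      using M.smult_one[of x] by (simp add: s a rsm)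
  qed
qed

abbreviation "pscale r \<equiv> Poly_Mapping.map ((*) (r::rat))"

lemma lookup_pscale [simp]: "Poly_Mapping.lookup (pscale r f) x = r * Poly_Mapping.lookup f x"
  by (simp add: Poly_Mapping.map.rep_eq when_def)

lemma keys_pscale: "Poly_Mapping.keys (pscale r f) \<subseteq> Poly_Mapping.keys f"
  by (auto simp: Poly_Mapping.in_keys_iff)

lemma fm_sel: "carrier (free_mod S) = {f. Poly_Mapping.keys f \<subseteq> S}"
  "add (free_mod S) = (+)" "ring.zero (free_mod S) = 0" "smult (free_mod S) = pscale"
  by (simp_all add: free_mod_def)

lemma module_free_mod: fixes S :: "'a set" shows "Module.module rat_ring (free_mod S)"
proof (rule moduleI)
  show "cring rat_ring" using field_rat_ring by (simp add: field_def domain_def)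
  show "abelian_group (free_mod S)"
  proof (rule abelian_groupI, unfold fm_sel mem_Collect_eq)
    fix x y :: "'a \<Rightarrow>\<^sub>0 rat" assume "Poly_Mapping.keys x \<subseteq> S" "Poly_Mapping.keys y \<subseteq> S"
    then show "Poly_Mapping.keys (x + y) \<subseteq> S" using Poly_Mapping.keys_add[of x y] by blast
  next
    fix x :: "'a \<Rightarrow>\<^sub>0 rat" assume "Poly_Mapping.keys x \<subseteq> S"
    then show "\<exists>y\<in>{f. Poly_Mapping.keys f \<subseteq> S}. y + x = 0"
      by (intro bexI[of _ "- x"]) (auto simp: in_keys_iff)
  qed (simp_all add: add.assoc add.commute)
next
  fix r x assume "x \<in> carrier (free_mod S)"
  then show "r \<odot>\<^bsub>free_mod S\<^esub> x \<in> carrier (free_mod S)"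
    using keys_pscale[of r x] by (simp add: fm_sel)
qed (simp_all only: fm_sel rat_ring_sel, (rule poly_mapping_eqI, simp add: lookup_add algebra_simps)+)

lemma module_free_nonassoc: "Module.module rat_ring (free_nonassoc S)"
proof -
  interpret F: Module.module rat_ring "free_mod {t. gens t \<subseteq> S}" by (rule module_free_mod)
  show ?thesis
    unfolding free_nonassoc_def
    apply (rule moduleI)
    using field_rat_ring F.abelian_group_axioms F.smult_closed F.smult_l_distr F.smult_r_distr F.smult_assoc1 F.smult_one
    by (simp_all add: field_def domain_def abelian_group_def abelian_monoid_def abelian_group_axioms_def)
qed

lemma formal_mult_superset:
  assumes "finite A" "finite B" "Poly_Mapping.keys f \<subseteq> A" "Poly_Mapping.keys g \<subseteq> B"
  shows "formal_mult f g = (\<Sum>s\<in>A. \<Sum>t\<in>B. Poly_Mapping.single (Br s t) (Poly_Mapping.lookup f s * Poly_Mapping.lookup g t))"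
proof -
  have "formal_mult f g = (\<Sum>s\<in>Poly_Mapping.keys f. \<Sum>t\<in>B. Poly_Mapping.single (Br s t) (Poly_Mapping.lookup f s * Poly_Mapping.lookup g t))"
    unfolding formal_mult_def
    by (intro sum.cong refl sum.mono_neutral_left) (use assms in \<open>auto simp: in_keys_iff\<close>)
  also have "\<dots> = (\<Sum>s\<in>A. \<Sum>t\<in>B. Poly_Mapping.single (Br s t) (Poly_Mapping.lookup f s * Poly_Mapping.lookup g t))"
    by (intro sum.mono_neutral_left) (use assms in \<open>auto simp: in_keys_iff\<close>)
  finally show ?thesis .
qed

lemma formal_mult_add_left: "formal_mult (f + g) h = formal_mult f h + formal_mult g h"
proof -
  let ?A = "Poly_Mapping.keys f \<union> Poly_Mapping.keys g"
  have "Poly_Mapping.keys (f+g) \<subseteq> ?A" by (rule Poly_Mapping.keys_add)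
  then show ?thesis
    by (simp add: formal_mult_superset[of ?A "Poly_Mapping.keys h"] lookup_add algebra_simps single_add sum.distrib)
qed

lemma formal_mult_add_right: "formal_mult h (f + g) = formal_mult h f + formal_mult h g"
proof -
  let ?A = "Poly_Mapping.keys f \<union> Poly_Mapping.keys g"
  have "Poly_Mapping.keys (f+g) \<subseteq> ?A" by (rule Poly_Mapping.keys_add)
  then show ?thesis
    by (simp add: formal_mult_superset[of "Poly_Mapping.keys h" ?A] lookup_add algebra_simps single_add sum.distrib)
qed

lemma pscale_add: "pscale r (f + g) = pscale r f + pscale r g"
  by (rule poly_mapping_eqI) (simp add: lookup_add algebra_simps)

lemma pscale_0: "pscale r 0 = 0"
  by (rule poly_mapping_eqI) simp

lemma pscale_sum: "pscale r (sum f A) = (\<Sum>a\<in>A. pscale r (f a))"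
  by (induction A rule: infinite_finite_induct) (simp_all add: pscale_add pscale_0)

lemma pscale_single: "pscale r (Poly_Mapping.single a c) = Poly_Mapping.single a (r * c)"
  by (rule poly_mapping_eqI) (simp add: lookup_single when_def)

lemma formal_mult_scale_left: "formal_mult (pscale r f) g = pscale r (formal_mult f g)"
proof -
  have "formal_mult (pscale r f) g = (\<Sum>s\<in>Poly_Mapping.keys f. \<Sum>t\<in>Poly_Mapping.keys g.
     Poly_Mapping.single (Br s t) (r * (Poly_Mapping.lookup f s * Poly_Mapping.lookup g t)))"
    by (subst formal_mult_superset[of "Poly_Mapping.keys f" "Poly_Mapping.keys g"])
      (simp_all only: keys_pscale finite_keys subset_refl lookup_pscale mult.assoc)
  then show ?thesis by (simp only: formal_mult_def pscale_sum pscale_single)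
qed

lemma formal_mult_scale_right: "formal_mult f (pscale r g) = pscale r (formal_mult f g)"
proof -
  have "formal_mult f (pscale r g) = (\<Sum>s\<in>Poly_Mapping.keys f. \<Sum>t\<in>Poly_Mapping.keys g.
     Poly_Mapping.single (Br s t) (r * (Poly_Mapping.lookup f s * Poly_Mapping.lookup g t)))"
    by (subst formal_mult_superset[of "Poly_Mapping.keys f" "Poly_Mapping.keys g"])
      (simp_all only: keys_pscale finite_keys subset_refl lookup_pscale mult.assoc mult.left_commute)
  then show ?thesis by (simp only: formal_mult_def pscale_sum pscale_single)
qed

lemma keys_sum_sub: "(\<And>a. a \<in> A \<Longrightarrow> Poly_Mapping.keys (f a) \<subseteq> T) \<Longrightarrow> Poly_Mapping.keys (sum f A) \<subseteq> T"
  using Poly_Mapping.keys_sum[of f A] by blast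

lemma fn_sel[simp]: "carrier (free_nonassoc S) = {f. Poly_Mapping.keys f \<subseteq> {t. gens t \<subseteq> S}}"
  "mult (free_nonassoc S) = formal_mult" "add (free_nonassoc S) = (+)"
  "ring.zero (free_nonassoc S) = 0" "smult (free_nonassoc S) = pscale"
  by (simp_all add: free_nonassoc_def free_mod_def)

lemma formal_mult_closed:
  assumes "f \<in> carrier (free_nonassoc S)" "g \<in> carrier (free_nonassoc S)"
  shows "formal_mult f g \<in> carrier (free_nonassoc S)"
proof -
  have "Poly_Mapping.keys (Poly_Mapping.single (Br s t) (Poly_Mapping.lookup f s * Poly_Mapping.lookup g t)) \<subseteq> {t. gens t \<subseteq> S}"
    if "s \<in> Poly_Mapping.keys f" "t \<in> Poly_Mapping.keys g" for s t
  proof -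
    have "gens s \<subseteq> S" "gens t \<subseteq> S" using that assms by (auto simp only: fn_sel)
    then show ?thesis by (simp add: Poly_Mapping.keys_single)
  qed
  then show ?thesis unfolding formal_mult_def fn_sel mem_Collect_eq
    by (intro keys_sum_sub) blast
qed

lemma lie_ideal_relation_ideal:
  assumes R: "R \<subseteq> carrier (free_nonassoc S)"
  shows "lie_ideal (free_nonassoc S) (relation_ideal S R)"
    and "lie_axiom_rels S \<union> R \<subseteq> relation_ideal S R"
proof -
  interpret F: Module.module rat_ring "free_nonassoc S" by (rule module_free_nonassoc)
  let ?F = "{I. lie_ideal (free_nonassoc S) I \<and> lie_axiom_rels S \<union> R \<subseteq> I}"
  have ax: "lie_axiom_rels S \<subseteq> carrier (free_nonassoc S)"
  proof
    have pc: "x \<in> carrier (free_nonassoc S) \<Longrightarrow> y \<in> carrier (free_nonassoc S) \<Longrightarrow> x + y \<in> carrier (free_nonassoc S)" for x y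
      using F.add.m_closed[of x y] by simp
    fix z assume "z \<in> lie_axiom_rels S"
    then consider a where "a \<in> carrier (free_nonassoc S)" "z = formal_mult a a"
      | a b c where "a \<in> carrier (free_nonassoc S)" "b \<in> carrier (free_nonassoc S)" "c \<in> carrier (free_nonassoc S)"
         "z = formal_mult a (formal_mult b c) + formal_mult b (formal_mult c a) + formal_mult c (formal_mult a b)"
      unfolding lie_axiom_rels_def by blast
    then show "z \<in> carrier (free_nonassoc S)"
      by cases (simp_all add: formal_mult_closed pc del: fn_sel)
  qed
  have whole: "carrier (free_nonassoc S) \<in> ?F"
    unfolding lie_ideal_def mem_Collect_eq using F.carrier_is_submodule formal_mult_closed R ax by (auto simp del: fn_sel(1))
  have "lie_ideal (free_nonassoc S) (\<Inter>?F)"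
  proof (rule lie_ideal_def[THEN iffD2], intro conjI ballI)
    show "submodule (\<Inter>?F) rat_ring (free_nonassoc S)"
    proof (rule F.submoduleI)
      show "\<Inter>?F \<subseteq> carrier (free_nonassoc S)" using whole by blast
      have z: "\<zero>\<^bsub>free_nonassoc S\<^esub> \<in> I" if "lie_ideal (free_nonassoc S) I" for I
        using that unfolding lie_ideal_def submodule_def using subgroup.one_closed by fastforce
      then show "\<zero>\<^bsub>free_nonassoc S\<^esub> \<in> \<Inter>?F" by blast
      show "\<ominus>\<^bsub>free_nonassoc S\<^esub> a \<in> \<Inter>?F" if "a \<in> \<Inter>?F" for a
        using that F.submoduleE(3) by (auto simp: lie_ideal_def simp del: fn_sel)
      show "a \<oplus>\<^bsub>free_nonassoc S\<^esub> b \<in> \<Inter>?F" if "a \<in> \<Inter>?F" "b \<in> \<Inter>?F" for a b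
        using that F.submoduleE(5) by (auto simp: lie_ideal_def simp del: fn_sel)
      show "a \<odot>\<^bsub>free_nonassoc S\<^esub> b \<in> \<Inter>?F" if "a \<in> carrier rat_ring" "b \<in> \<Inter>?F" for a b
        using that F.submoduleE(4) by (auto simp: lie_ideal_def simp del: fn_sel)
    qed
  qed (auto simp: lie_ideal_def simp del: fn_sel)
  then show "lie_ideal (free_nonassoc S) (relation_ideal S R)" by (simp add: relation_ideal_def hull_def)
  show "lie_axiom_rels S \<union> R \<subseteq> relation_ideal S R" unfolding relation_ideal_def by (rule hull_subset)
qed

lemma lie_presented:
  assumes R: "R \<subseteq> carrier (free_nonassoc S)"
  shows "lie_algebra (presented_lie S R)"
proof -
  let ?F = "free_nonassoc S" and ?N = "relation_ideal S R" let ?Q = "quot_mod ?F ?N"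
  interpret M: Module.module rat_ring ?F by (rule module_free_nonassoc)
  have li: "lie_ideal ?F ?N" and sub: "lie_axiom_rels S \<union> R \<subseteq> ?N" using lie_ideal_relation_ideal[OF R] by auto
  have sm: "submodule ?N rat_ring ?F" using li by (simp add: lie_ideal_def)
  interpret N: submodule ?N rat_ring ?F by (rule sm)
  have ag: "abelian_group ?F" by (rule M.abelian_group_axioms)
  interpret S: abelian_subgroup ?N ?F
    by (rule abelian_subgroupI3) (simp_all add: additive_subgroup_def N.subgroup_axioms ag del: fn_sel)
  have modQ: "Module.module rat_ring ?Q" by (rule module_quot_mod[OF module_free_nonassoc sm])
  have in0: "?N +>\<^bsub>?F\<^esub> x = ?N" if "x \<in> ?N" for x
    using that S.a_rcos_const by blast
  have eqI: "?N +>\<^bsub>?F\<^esub> x = ?N +>\<^bsub>?F\<^esub> y" if "x = h + y" "h \<in> ?N" "y \<in> carrier ?F" for x y h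
    using S.a_repr_independence'[of x y] that by (auto simp: a_r_coset_def' simp del: fn_sel(1))
  have pc: "x \<in> carrier ?F \<Longrightarrow> y \<in> carrier ?F \<Longrightarrow> x + y \<in> carrier ?F" for x y
    using M.add.m_closed[of x y] by simp
  have mlt: "rcoset_mult ?F ?N (?N +>\<^bsub>?F\<^esub> x) (?N +>\<^bsub>?F\<^esub> y) = ?N +>\<^bsub>?F\<^esub> formal_mult x y"
    if x: "x \<in> carrier ?F" and y: "y \<in> carrier ?F" for x y
  proof -
    have "?N +>\<^bsub>?F\<^esub> formal_mult a b = ?N +>\<^bsub>?F\<^esub> formal_mult x y"
      if A: "a \<in> ?N +>\<^bsub>?F\<^esub> x" and B: "b \<in> ?N +>\<^bsub>?F\<^esub> y" for a b
    proof -
      obtain h where h: "h \<in> ?N" "a = h + x" using A by (auto simp: a_r_coset_def')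
      obtain k where k: "k \<in> ?N" "b = k + y" using B by (auto simp: a_r_coset_def')
      note hk = h(1) k(1) h(2) k(2)
      have hc: "h \<in> carrier ?F" "k \<in> carrier ?F" using hk S.a_Hcarr by blast+
      have bc: "b \<in> carrier ?F" unfolding hk(4) using hc y by (intro pc)
      have n1: "formal_mult h b \<in> ?N" using li hk bc unfolding lie_ideal_def by simp
      have n2: "formal_mult x k \<in> ?N" using li hk x unfolding lie_ideal_def by simp
      have "formal_mult h b + formal_mult x k \<in> ?N" using n1 n2 S.a_closed by simp
      moreover have "formal_mult a b = (formal_mult h b + formal_mult x k) + formal_mult x y"
        by (simp add: hk formal_mult_add_left formal_mult_add_right)
      ultimately show ?thesis using eqI formal_mult_closed x y by blast
    qed
    moreover have "x \<in> ?N +>\<^bsub>?F\<^esub> x" "y \<in> ?N +>\<^bsub>?F\<^esub> y" using x y S.a_rcos_self by blast+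
    ultimately show ?thesis unfolding rcoset_mult_def fn_sel by blast
  qed
  have rep: "\<exists>x\<in>carrier ?F. A = ?N +>\<^bsub>?F\<^esub> x" if "A \<in> carrier ?Q" for A
    using that by (auto simp: A_RCOSETS_def' quot_mod_def)
  have c: "x \<in> carrier ?F \<Longrightarrow> ?N +>\<^bsub>?F\<^esub> x \<in> carrier ?Q" for x
    by (auto simp: A_RCOSETS_def' quot_mod_def)
  have m: "x \<in> carrier ?F \<Longrightarrow> y \<in> carrier ?F \<Longrightarrow> (?N +>\<^bsub>?F\<^esub> x) \<otimes>\<^bsub>?Q\<^esub> (?N +>\<^bsub>?F\<^esub> y) = ?N +>\<^bsub>?F\<^esub> formal_mult x y" for x y
    using mlt by (simp add: quot_mod_def)
  have a: "x \<in> carrier ?F \<Longrightarrow> y \<in> carrier ?F \<Longrightarrow> (?N +>\<^bsub>?F\<^esub> x) \<oplus>\<^bsub>?Q\<^esub> (?N +>\<^bsub>?F\<^esub> y) = ?N +>\<^bsub>?F\<^esub> (x + y)" for x y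
    using S.a_rcos_sum by (simp add: quot_mod_def)
  have s: "r \<odot>\<^bsub>?Q\<^esub> (?N +>\<^bsub>?F\<^esub> x) = ?N +>\<^bsub>?F\<^esub> pscale r x" if x: "x \<in> carrier ?F" for r x
  proof -
    have "?N +>\<^bsub>?F\<^esub> pscale r b = ?N +>\<^bsub>?F\<^esub> pscale r x" if B: "b \<in> ?N +>\<^bsub>?F\<^esub> x" for b
    proof -
      obtain h where h: "h \<in> ?N" "b = h + x" using B by (auto simp: a_r_coset_def')
      have "pscale r h \<in> ?N" using N.smult_closed[of r h] h by simp
      then show ?thesis using eqI[of "pscale r b" "pscale r h" "pscale r x"] h M.smult_closed[of r x] x
        by (simp add: pscale_add del: fn_sel(1))
    qed
    moreover have "x \<in> ?N +>\<^bsub>?F\<^esub> x" using x S.a_rcos_self by blast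
    ultimately have "(\<Union>b\<in>?N +>\<^bsub>?F\<^esub> x. ?N +>\<^bsub>?F\<^esub> pscale r b) = ?N +>\<^bsub>?F\<^esub> pscale r x" by blast
    then show ?thesis by (simp add: quot_mod_def)
  qed
  have sc: "x \<in> carrier ?F \<Longrightarrow> pscale r x \<in> carrier ?F" for x r
    using M.smult_closed[of r x] by simp
  have z: "\<zero>\<^bsub>?Q\<^esub> = ?N" by (simp add: quot_mod_def)
  note fc = formal_mult_closed
  note R = m a s c fc pc sc z
  show ?thesis
    unfolding lie_algebra_def presented_lie_def
  proof (intro conjI ballI allI)
    show "Module.module rat_ring ?Q" by (rule modQ)
  next
    fix A B assume "A \<in> carrier ?Q" "B \<in> carrier ?Q"
    then obtain x y where "x \<in> carrier ?F" "A = ?N +>\<^bsub>?F\<^esub> x" "y \<in> carrier ?F" "B = ?N +>\<^bsub>?F\<^esub> y" using rep by metis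
    then show "A \<otimes>\<^bsub>?Q\<^esub> B \<in> carrier ?Q" by (simp only: R)
  next
    fix r A B assume "A \<in> carrier ?Q" "B \<in> carrier ?Q"
    then obtain x y where "x \<in> carrier ?F" "A = ?N +>\<^bsub>?F\<^esub> x" "y \<in> carrier ?F" "B = ?N +>\<^bsub>?F\<^esub> y" using rep by metis
    then show "(r \<odot>\<^bsub>?Q\<^esub> A) \<otimes>\<^bsub>?Q\<^esub> B = r \<odot>\<^bsub>?Q\<^esub> (A \<otimes>\<^bsub>?Q\<^esub> B)" "A \<otimes>\<^bsub>?Q\<^esub> (r \<odot>\<^bsub>?Q\<^esub> B) = r \<odot>\<^bsub>?Q\<^esub> (A \<otimes>\<^bsub>?Q\<^esub> B)"
      by (simp_all only: R formal_mult_scale_left formal_mult_scale_right)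
  next
    fix A assume "A \<in> carrier ?Q"
    then obtain x where x: "x \<in> carrier ?F" "A = ?N +>\<^bsub>?F\<^esub> x" using rep by metis
    have "formal_mult x x \<in> ?N" using sub x unfolding lie_axiom_rels_def by blast
    then show "A \<otimes>\<^bsub>?Q\<^esub> A = \<zero>\<^bsub>?Q\<^esub>" using x by (simp only: R in0)
  next
    fix A B C assume "A \<in> carrier ?Q" "B \<in> carrier ?Q" "C \<in> carrier ?Q"
    then obtain x y w where "x \<in> carrier ?F" "A = ?N +>\<^bsub>?F\<^esub> x" "y \<in> carrier ?F" "B = ?N +>\<^bsub>?F\<^esub> y" 
     "w \<in> carrier ?F" "C = ?N +>\<^bsub>?F\<^esub> w" using rep by metis
    note xyz = this
    show "(A \<oplus>\<^bsub>?Q\<^esub> B) \<otimes>\<^bsub>?Q\<^esub> C = A \<otimes>\<^bsub>?Q\<^esub> C \<oplus>\<^bsub>?Q\<^esub> B \<otimes>\<^bsub>?Q\<^esub> C" "C \<otimes>\<^bsub>?Q\<^esub> (A \<oplus>\<^bsub>?Q\<^esub> B) = C \<otimes>\<^bsub>?Q\<^esub> A \<oplus>\<^bsub>?Q\<^esub> C \<otimes>\<^bsub>?Q\<^esub> B"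
      using xyz by (simp_all only: R formal_mult_add_left formal_mult_add_right)
    have "formal_mult x (formal_mult y w) + formal_mult y (formal_mult w x) + formal_mult w (formal_mult x y) \<in> ?N"
      using sub xyz unfolding lie_axiom_rels_def by blast
    then show "A \<otimes>\<^bsub>?Q\<^esub> (B \<otimes>\<^bsub>?Q\<^esub> C) \<oplus>\<^bsub>?Q\<^esub> (B \<otimes>\<^bsub>?Q\<^esub> (C \<otimes>\<^bsub>?Q\<^esub> A) \<oplus>\<^bsub>?Q\<^esub> C \<otimes>\<^bsub>?Q\<^esub> (A \<otimes>\<^bsub>?Q\<^esub> B)) = \<zero>\<^bsub>?Q\<^esub>"
      using xyz by (simp only: R in0 add.assoc)
  qed
qed

lemma formal_x_in: "i \<in> {1..n} \<Longrightarrow> j \<in> {1..n} \<Longrightarrow> formal_x i j \<in> carrier (free_nonassoc (Bo_gens n))"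
  by (auto simp: formal_gen_def Bo_gens_def)

lemma diff_in: "x \<in> carrier (free_nonassoc S) \<Longrightarrow> y \<in> carrier (free_nonassoc S) \<Longrightarrow> x - y \<in> carrier (free_nonassoc S)"
  using Poly_Mapping.keys_diff[of x y] by auto

lemma lie_Bo: "lie_algebra (Bo n)"
  unfolding Bo_def
proof (rule lie_presented)
  show "Bo_rels n \<subseteq> carrier (free_nonassoc (Bo_gens n))"
    unfolding Bo_rels_def by (intro Un_least subsetI; clarify; intro diff_in formal_mult_closed formal_x_in; assumption)
qed

lemma lie_Lambda: "lie_algebra Lambda_o"
  unfolding Lambda_o_def by (rule lie_presented) simp

lemma lie_algebra_lie_sum:
  assumes L: "lie_algebra L" and K: "lie_algebra K"
  shows "lie_algebra (lie_sum L K)"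
proof -
  have mL: "Module.module rat_ring L" and mK: "Module.module rat_ring K"
    using assms by (simp_all add: lie_algebra_def)
  interpret L: Module.module rat_ring L by (rule mL)
  interpret K: Module.module rat_ring K by (rule mK)
  have mod: "Module.module rat_ring (lie_sum L K)"
  proof (rule moduleI)
    show "cring rat_ring" by (rule L.R.is_cring)
    show "abelian_group (lie_sum L K)"
    proof (rule abelian_groupI)
      fix p assume "p \<in> carrier (lie_sum L K)"
      then show "\<exists>q\<in>carrier (lie_sum L K). q \<oplus>\<^bsub>lie_sum L K\<^esub> p = \<zero>\<^bsub>lie_sum L K\<^esub>"
        by (intro bexI[of _ "(\<ominus>\<^bsub>L\<^esub> fst p, \<ominus>\<^bsub>K\<^esub> snd p)"]) (auto simp: lie_sum_def L.M.l_neg K.M.l_neg)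
    qed (auto simp: lie_sum_def L.M.a_ac K.M.a_ac)
  qed (use L.smult_closed K.smult_closed L.smult_l_distr K.smult_l_distr L.smult_r_distr
      K.smult_r_distr L.smult_assoc1 K.smult_assoc1 L.smult_one K.smult_one in \<open>auto simp: lie_sum_def\<close>)
  show ?thesis
    using L K unfolding lie_algebra_def
    by (intro conjI) (auto simp: mod, auto simp: lie_sum_def)
qed

lemma lie_algebra_lie_copies:
  assumes L: "lie_algebra L"
  shows "lie_algebra (lie_copies n L)"
proof -
  let ?C = "lie_copies n L"
  have mL: "Module.module rat_ring L" using L unfolding lie_algebra_def by blast
  interpret L: Module.module rat_ring L by (rule mL)
  have ext: "f = g" if "f \<in> carrier ?C" "g \<in> carrier ?C" "\<And>i. i \<in> {1..n} \<Longrightarrow> f i = g i" for f g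
    by (rule PiE_ext[of f "{1..n}" "\<lambda>_. carrier L" g]) (use that in \<open>simp_all add: lie_copies_def\<close>)
  have app: "f i \<in> carrier L" if "f \<in> carrier ?C" "i \<in> {1..n}" for f i
    by (rule PiE_mem[of f "{1..n}" "\<lambda>_. carrier L"]) (use that in \<open>simp_all add: lie_copies_def\<close>)
  have at: "(f \<oplus>\<^bsub>?C\<^esub> g) i = f i \<oplus>\<^bsub>L\<^esub> g i" "(f \<otimes>\<^bsub>?C\<^esub> g) i = f i \<otimes>\<^bsub>L\<^esub> g i"
    "(r \<odot>\<^bsub>?C\<^esub> f) i = r \<odot>\<^bsub>L\<^esub> f i" "\<zero>\<^bsub>?C\<^esub> i = \<zero>\<^bsub>L\<^esub>" if "i \<in> {1..n}" for f g r i
    using that by (simp_all add: lie_copies_def)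
  have mem: "f \<in> carrier ?C" if "\<And>i. i \<in> {1..n} \<Longrightarrow> f i \<in> carrier L" "f \<in> extensional {1..n}" for f
    using that by (simp add: lie_copies_def PiE_def Pi_def)
  have ex: "f \<oplus>\<^bsub>?C\<^esub> g \<in> extensional {1..n}" "f \<otimes>\<^bsub>?C\<^esub> g \<in> extensional {1..n}"
    "r \<odot>\<^bsub>?C\<^esub> f \<in> extensional {1..n}" "\<zero>\<^bsub>?C\<^esub> \<in> extensional {1..n}" for f g r
    by (simp_all add: lie_copies_def)
  have sL: "x \<in> carrier L \<Longrightarrow> r \<odot>\<^bsub>L\<^esub> x \<in> carrier L" for r x
    using L.smult_closed[of r x] by (simp add: rat_ring_def)
  have bL: "x \<in> carrier L \<Longrightarrow> y \<in> carrier L \<Longrightarrow> x \<otimes>\<^bsub>L\<^esub> y \<in> carrier L" for x y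
    using L unfolding lie_algebra_def by blast
  have cl1: "f \<oplus>\<^bsub>?C\<^esub> g \<in> carrier ?C" "f \<otimes>\<^bsub>?C\<^esub> g \<in> carrier ?C" "r \<odot>\<^bsub>?C\<^esub> f \<in> carrier ?C"
    if f: "f \<in> carrier ?C" and g: "g \<in> carrier ?C" for f g r
    by (rule mem, simp only: at app[OF f] app[OF g] sL bL L.M.a_closed, rule ex)+
  have cl0: "\<zero>\<^bsub>?C\<^esub> \<in> carrier ?C" by (rule mem, simp only: at L.M.zero_closed, rule ex)
  have cl: "f \<in> carrier ?C \<Longrightarrow> g \<in> carrier ?C \<Longrightarrow> f \<oplus>\<^bsub>?C\<^esub> g \<in> carrier ?C"
    "f \<in> carrier ?C \<Longrightarrow> g \<in> carrier ?C \<Longrightarrow> f \<otimes>\<^bsub>?C\<^esub> g \<in> carrier ?C"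
    "f \<in> carrier ?C \<Longrightarrow> r \<odot>\<^bsub>?C\<^esub> f \<in> carrier ?C" "\<zero>\<^bsub>?C\<^esub> \<in> carrier ?C" for f g r
    using cl1(1,2)[of f g] cl1(3)[of f f] cl0 by simp_all
  have rat: "carrier rat_ring = UNIV" by (simp add: rat_ring_def)
  have mod: "Module.module rat_ring ?C"
  proof (rule moduleI)
    show "cring rat_ring" by (rule L.R.is_cring)
    show "abelian_group ?C"
    proof (rule abelian_groupI)
      fix f assume f: "f \<in> carrier ?C"
      have g: "(\<lambda>i\<in>{1..n}. \<ominus>\<^bsub>L\<^esub> f i) \<in> carrier ?C" by (rule mem) (simp_all add: app[OF f])
      show "\<exists>g\<in>carrier ?C. g \<oplus>\<^bsub>?C\<^esub> f = \<zero>\<^bsub>?C\<^esub>"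
        by (rule bexI[OF _ g], rule ext, rule cl(1)[OF g f], rule cl(4)) (simp only: at restrict_apply' app[OF f] L.M.l_neg)
      show "\<zero>\<^bsub>?C\<^esub> \<oplus>\<^bsub>?C\<^esub> f = f" by (rule ext) (simp_all add: cl f at app[OF f])
    next
      fix f g h assume f: "f \<in> carrier ?C" "g \<in> carrier ?C" 
      show "f \<oplus>\<^bsub>?C\<^esub> g = g \<oplus>\<^bsub>?C\<^esub> f" by (rule ext) (simp_all add: cl f at app[OF f(1)] app[OF f(2)] L.M.a_comm)
      assume h: "h \<in> carrier ?C"
      show "f \<oplus>\<^bsub>?C\<^esub> g \<oplus>\<^bsub>?C\<^esub> h = f \<oplus>\<^bsub>?C\<^esub> (g \<oplus>\<^bsub>?C\<^esub> h)"
        by (rule ext) (simp_all add: cl f h at app[OF f(1)] app[OF f(2)] app[OF h] L.M.a_assoc)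
    qed (simp_all add: cl)
  next
    fix r q f g assume f: "f \<in> carrier ?C"
    show "(r \<oplus>\<^bsub>rat_ring\<^esub> q) \<odot>\<^bsub>?C\<^esub> f = r \<odot>\<^bsub>?C\<^esub> f \<oplus>\<^bsub>?C\<^esub> q \<odot>\<^bsub>?C\<^esub> f"
      by (rule ext) (simp_all only: cl f at app[OF f] rat L.smult_l_distr UNIV_I)
    show "(r \<otimes>\<^bsub>rat_ring\<^esub> q) \<odot>\<^bsub>?C\<^esub> f = r \<odot>\<^bsub>?C\<^esub> (q \<odot>\<^bsub>?C\<^esub> f)"
      by (rule ext) (simp_all only: cl f at app[OF f] rat L.smult_assoc1 UNIV_I)
    show "\<one>\<^bsub>rat_ring\<^esub> \<odot>\<^bsub>?C\<^esub> f = f" by (rule ext) (simp_all only: cl f at app[OF f] L.smult_one)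
    assume g: "g \<in> carrier ?C"
    show "r \<odot>\<^bsub>?C\<^esub> (f \<oplus>\<^bsub>?C\<^esub> g) = r \<odot>\<^bsub>?C\<^esub> f \<oplus>\<^bsub>?C\<^esub> r \<odot>\<^bsub>?C\<^esub> g"
      by (rule ext) (simp_all only: cl f g at app[OF f] app[OF g] rat L.smult_r_distr UNIV_I)
  qed (simp add: cl)
  have LD: "x \<in> carrier L \<Longrightarrow> y \<in> carrier L \<Longrightarrow> z \<in> carrier L \<Longrightarrow>
        (x \<oplus>\<^bsub>L\<^esub> y) \<otimes>\<^bsub>L\<^esub> z = (x \<otimes>\<^bsub>L\<^esub> z) \<oplus>\<^bsub>L\<^esub> (y \<otimes>\<^bsub>L\<^esub> z)"
      "x \<in> carrier L \<Longrightarrow> y \<in> carrier L \<Longrightarrow> z \<in> carrier L \<Longrightarrow>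
        z \<otimes>\<^bsub>L\<^esub> (x \<oplus>\<^bsub>L\<^esub> y) = (z \<otimes>\<^bsub>L\<^esub> x) \<oplus>\<^bsub>L\<^esub> (z \<otimes>\<^bsub>L\<^esub> y)"
      "x \<in> carrier L \<Longrightarrow> y \<in> carrier L \<Longrightarrow> (r \<odot>\<^bsub>L\<^esub> x) \<otimes>\<^bsub>L\<^esub> y = r \<odot>\<^bsub>L\<^esub> (x \<otimes>\<^bsub>L\<^esub> y)"
      "x \<in> carrier L \<Longrightarrow> y \<in> carrier L \<Longrightarrow> x \<otimes>\<^bsub>L\<^esub> (r \<odot>\<^bsub>L\<^esub> y) = r \<odot>\<^bsub>L\<^esub> (x \<otimes>\<^bsub>L\<^esub> y)"
      "x \<in> carrier L \<Longrightarrow> x \<otimes>\<^bsub>L\<^esub> x = \<zero>\<^bsub>L\<^esub>"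
      "x \<in> carrier L \<Longrightarrow> y \<in> carrier L \<Longrightarrow> z \<in> carrier L \<Longrightarrow>
        x \<otimes>\<^bsub>L\<^esub> (y \<otimes>\<^bsub>L\<^esub> z) \<oplus>\<^bsub>L\<^esub> (y \<otimes>\<^bsub>L\<^esub> (z \<otimes>\<^bsub>L\<^esub> x) \<oplus>\<^bsub>L\<^esub> z \<otimes>\<^bsub>L\<^esub> (x \<otimes>\<^bsub>L\<^esub> y)) = \<zero>\<^bsub>L\<^esub>"
    for x y z r
    using L unfolding lie_algebra_def by blast+
  show ?thesis
    unfolding lie_algebra_def
  proof (intro conjI ballI allI)
    show "Module.module rat_ring ?C" by (rule mod)
  next
    fix f g assume "f \<in> carrier ?C" "g \<in> carrier ?C"
    then show "f \<otimes>\<^bsub>?C\<^esub> g \<in> carrier ?C" by (rule cl)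
  next
    fix r f g assume f: "f \<in> carrier ?C" "g \<in> carrier ?C"
    show "(r \<odot>\<^bsub>?C\<^esub> f) \<otimes>\<^bsub>?C\<^esub> g = r \<odot>\<^bsub>?C\<^esub> (f \<otimes>\<^bsub>?C\<^esub> g)"
      by (rule ext) (simp_all only: cl f at app[OF f(1)] app[OF f(2)] LD)
    show "f \<otimes>\<^bsub>?C\<^esub> (r \<odot>\<^bsub>?C\<^esub> g) = r \<odot>\<^bsub>?C\<^esub> (f \<otimes>\<^bsub>?C\<^esub> g)"
      by (rule ext) (simp_all only: cl f at app[OF f(1)] app[OF f(2)] LD)
  next
    fix f assume f: "f \<in> carrier ?C"
    show "f \<otimes>\<^bsub>?C\<^esub> f = \<zero>\<^bsub>?C\<^esub>" by (rule ext) (simp_all only: cl f at app[OF f] LD)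
  next
    fix f g h assume f: "f \<in> carrier ?C" "g \<in> carrier ?C" "h \<in> carrier ?C"
    show "(f \<oplus>\<^bsub>?C\<^esub> g) \<otimes>\<^bsub>?C\<^esub> h = f \<otimes>\<^bsub>?C\<^esub> h \<oplus>\<^bsub>?C\<^esub> g \<otimes>\<^bsub>?C\<^esub> h"
      by (rule ext) (simp_all only: cl f at app[OF f(1)] app[OF f(2)] app[OF f(3)] LD)
    show "h \<otimes>\<^bsub>?C\<^esub> (f \<oplus>\<^bsub>?C\<^esub> g) = h \<otimes>\<^bsub>?C\<^esub> f \<oplus>\<^bsub>?C\<^esub> h \<otimes>\<^bsub>?C\<^esub> g"
      by (rule ext) (simp_all only: cl f at app[OF f(1)] app[OF f(2)] app[OF f(3)] LD)
    show "f \<otimes>\<^bsub>?C\<^esub> (g \<otimes>\<^bsub>?C\<^esub> h) \<oplus>\<^bsub>?C\<^esub> (g \<otimes>\<^bsub>?C\<^esub> (h \<otimes>\<^bsub>?C\<^esub> f) \<oplus>\<^bsub>?C\<^esub> h \<otimes>\<^bsub>?C\<^esub> (f \<otimes>\<^bsub>?C\<^esub> g)) = \<zero>\<^bsub>?C\<^esub>"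
      by (rule ext) (simp_all only: cl f at app[OF f(1)] app[OF f(2)] app[OF f(3)] LD)
  qed
qed

lemma lie_algebra_BTo: "lie_algebra (BTo n)"
  unfolding BTo_def by (intro lie_algebra_lie_sum lie_algebra_lie_copies lie_Bo lie_Lambda)

lemma topspace_emb_topology: "topspace (emb_topology a b u v) = emb_space a b u v"
proof -
  have "f \<in> topspace (emb_topology a b u v)" if "f \<in> emb_space a b u v" for f
    unfolding emb_topology_def topology_generated_by_topspace
    using that by (auto intro!: exI[of _ "{g \<in> emb_space a b u v. \<forall>t\<in>{0..1}. dist (nth_deriv 0 g t) (nth_deriv 0 f t) < 1}"]) (metis zero_less_one)
  then show ?thesis unfolding emb_topology_def topology_generated_by_topspace by auto
qed

declare rat_ring_sel [simp del] lookup_pscale [simp del] fn_sel [simp del]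

end

theory Submission
  imports Defs
begin

text \<open>The vanishing is a count of indices. For \<open>n > 1\<close>, \<open>M_mod d n\<close>
  is spanned by brackets with \<open>d\<close> leaves in which all \<open>n - 1\<close> indices
  occur, so no such bracket exists once \<open>d < n - 1\<close>
  (\<open>carrier_M_mod_eq_zero\<close>). In a nonzero position \<open>p = n\<close>,
  \<open>q = d(k-1) + 1\<close>, the bound on \<open>q\<close> is equivalent to exactly this
  inequality, and \<open>zero_mod_iso\<close> carries the vanishing over to the first page.\<close>

text \<open>The weight counts leaves with repetition, \<open>gens\<close> without.\<close>

lemma card_gens_le_weight: "card (gens t) \<le> weight t"
proof (induction t)
  case (Br s t)
  have "card (gens s \<union> gens t) \<le> card (gens s) + card (gens t)" by (rule card_Un_le)
  with Br show ?case by simp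
qed simp

lemma mod_span_empty:
  assumes "Module.module rat_ring M"
  shows "mod_span M {} = {\<zero>\<^bsub>M\<^esub>}"
proof -
  interpret Module.module rat_ring M by fact
  have "submodule {\<zero>\<^bsub>M\<^esub>} rat_ring M"
    by (rule submoduleI) simp_all
  moreover have "\<zero>\<^bsub>M\<^esub> \<in> H" if "submodule H rat_ring M" for H
    using subgroup.one_closed[OF submodule.axioms(1)[OF that]] by simp
  ultimately show ?thesis
    unfolding mod_span_def by (intro hull_unique) auto
qed

lemma carrier_M_mod_eq_zero:
  assumes "d + 1 < n"
  shows "carrier (M_mod d n) = {\<zero>\<^bsub>BTo n\<^esub>}"
proof -
  \<comment> \<open>The target set has \<open>n - 1 > d\<close> elements.\<close>
  have "gens t \<noteq> {1..n-1}" if "weight t = d" for t :: "nat bracket"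
    using card_gens_le_weight[of t] that assms by auto
  then have no_brackets:
    "{eval_bracket (BTo n) (\<lambda>i. x_gen n i n) t | t. weight t = d \<and> gens t = {1..n-1}} = {}"
    by blast
  have "Module.module rat_ring (BTo n)"
    using lie_algebra_BTo unfolding lie_algebra_def by blast
  \<comment> \<open>The assumption also gives \<open>n > 1\<close>, which selects the spanning
    branch of \<open>M_mod\<close>.\<close>
  then show ?thesis
    using assms unfolding M_mod_def no_brackets
    by (simp add: restrict_mod_def mod_span_empty)
qed

text \<open>The image of an additive idempotent is idempotent, hence zero in \<open>N\<close>.
  Phrasing it through \<open>z\<close> lets it apply to the record \<open>M_mod d n\<close>
  directly, without a proof that this restriction is a module.\<close>

lemma zero_mod_iso:
  assumes f: "f \<in> mod_iso M N" and N: "Module.module rat_ring N"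
    and z: "carrier M = {z}" "z \<oplus>\<^bsub>M\<^esub> z = z"
  shows "zero_mod N"
proof -
  interpret N: Module.module rat_ring N by fact
  have fz: "f z \<in> carrier N" "f z = f z \<oplus>\<^bsub>N\<^esub> f z"
    using f z by (force simp: mod_iso_def mod_hom_def)+
  then have "f z = \<zero>\<^bsub>N\<^esub>"
    using N.M.add.l_cancel_one by metis
  moreover have "carrier N = {f z}"
    using f z by (auto simp: mod_iso_def bij_betw_def)
  ultimately show ?thesis
    by (simp add: zero_mod_def)
qed

theorem corollary4p5:
  fixes k :: nat
    and a b :: "real ^ 'k" and u v :: "(real ^ 'k) \<times> real"
    and \<gamma> :: "real \<Rightarrow> (real ^ 'k) \<times> real"
    and E :: "nat \<Rightarrow> int \<Rightarrow> int \<Rightarrow> (rat, 'v) module"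
    and D :: "nat \<Rightarrow> int \<Rightarrow> int \<Rightarrow> 'v \<Rightarrow> 'v"
    and \<theta> :: "nat \<Rightarrow> nat \<Rightarrow> bto \<Rightarrow> 'v"
    and \<delta> :: "nat \<Rightarrow> nat \<Rightarrow> bto \<Rightarrow> bto"
  assumes "k = CARD('k)" and "k \<ge> 3" and "odd k"
    and "snd u > 0" and "snd v > 0" and "\<gamma> \<in> emb_space a b u v"
    and "spectral_sequence E D"
    and "converges_to E D (rational_homotopy (emb_topology a b u v) \<gamma>)"
    and "\<And>n d. d \<ge> 1 \<Longrightarrow>
           \<theta> d n \<in> mod_iso (M_mod d n) (E 1 (- int n) (int d * (int k - 1) + 1))"
    and "\<And>p q. (\<nexists>n d. d \<ge> 1 \<and> p = - int n \<and> q = int d * (int k - 1) + 1) \<Longrightarrow>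
           zero_mod (E 1 p q)"
    and "\<And>n l. l \<le> n + 1 \<Longrightarrow> is_coface n l (\<delta> n l)"
    and "\<And>n d x. d \<ge> 1 \<Longrightarrow> x \<in> carrier (M_mod d n) \<Longrightarrow>
           D 1 (- int n) (int d * (int k - 1) + 1) (\<theta> d n x) = \<theta> d (n + 1) (coface_sum \<delta> n x)"
  shows "\<forall>p q :: int. q < p * (int k - 1) + 2 - int k \<longrightarrow> zero_mod (E 1 (- p) q)"
proof (intro allI impI)
  fix p q :: int
  assume less: "q < p * (int k - 1) + 2 - int k"
  show "zero_mod (E 1 (- p) q)"
  proof (cases "\<exists>n d. d \<ge> 1 \<and> - p = - int n \<and> q = int d * (int k - 1) + 1")
    \<comment> \<open>This includes every negative \<open>p\<close>.\<close>
    case False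
    then show ?thesis
      by (rule assms(10))
  next
    case True
    then obtain n d where nd: "d \<ge> 1" "p = int n" "q = int d * (int k - 1) + 1"
      by auto
    \<comment> \<open>Moving the \<open>1\<close> of \<open>q\<close> across leaves
      \<open>1 - k\<close>, which removes one copy of \<open>k - 1\<close>. Working in
      \<open>int\<close> keeps \<open>n - 1\<close> exact when \<open>n = 0\<close>.\<close>
    have "int d * (int k - 1) < (int n - 1) * (int k - 1)"
      using less nd by (simp add: algebra_simps)
    \<comment> \<open>The factor \<open>k - 1\<close> is positive and cancels.\<close>
    then have "d + 1 < n"
      using \<open>k \<ge> 3\<close> by (simp add: mult_less_cancel_right)
    then have M: "carrier (M_mod d n) = {\<zero>\<^bsub>BTo n\<^esub>}"
      using nd by (intro carrier_M_mod_eq_zero)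
    interpret B: Module.module rat_ring "BTo n"
      using lie_algebra_BTo unfolding lie_algebra_def by blast
    have "Module.module rat_ring (E 1 (- p) q)"
      using \<open>spectral_sequence E D\<close> unfolding spectral_sequence_def by blast
    moreover have "\<theta> d n \<in> mod_iso (M_mod d n) (E 1 (- p) q)"
      using assms(9)[OF nd(1)] nd by simp
    moreover have "\<zero>\<^bsub>BTo n\<^esub> \<oplus>\<^bsub>M_mod d n\<^esub> \<zero>\<^bsub>BTo n\<^esub> = \<zero>\<^bsub>BTo n\<^esub>"
      by (simp add: M_mod_def restrict_mod_def)
    ultimately show ?thesis
      using M by (intro zero_mod_iso)
  qed
qed

end
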